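(* Let $G=(V,E)$ be a finite connected undirected graph with $n=|V|$ vertices modelling a wireless sensor network. The worst-case time complexity (network wide) of the Basic Distributed Greedy Vertex Cover Algorithm run on $G$ is $O(\log_2 n)$.
   Context: Network model: vertices are identical nodes with unique identifiers, edges are unweighted communication links, each node knows its neighbors, and nodes are time-synchronized and operate in synchronous rounds. Rounds are long enough that all messages sent in a round are delivered (with acknowledgement) within that round. $\Delta$ denotes the maximum degree of $G$, and every node knows $\Delta$. Basic Distributed Greedy Vertex Cover Algorithm: each node keeps a list of its currently active neighbors, its current degree MyDegree (initially its degree in $G$), and a round counter $R$, initially $0$. At the start of each round, every node not already in the cover set does the following: it sets $R:=R+1$; if $R>\log_2\Delta$ it terminates; otherwise, if $\mathrm{MyDegree}>\Delta/2^R$, it declares itself a member of the cover set, sends a "drop" message to each of its remaining neighbors of non-zero degree, and takes no further part in later rounds; otherwise it waits for the next round. A node receiving a "drop" message deletes the sender from its neighbor list and decreases MyDegree by $1$. Time convention: the time complexity is the worst-case number of time units until termination, where the messaging of one round (each node sending to its neighbors) takes one time unit. *)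

theory Defs
  imports
    Complex_Main
    "HOL-Library.Extended_Nat"
    "HOL-Library.Landau_Symbols"
    "Graph_Theory.Graph_Theory"
begin

text \<open>
  An undirected simple graph is a symmetric, loop-free digraph whose arcs are pairs of vertices
  (locale \<^locale>\<open>pair_graph\<close>, which also demands finiteness); an undirected edge is a pair of
  opposite arcs, so the out-degree of a vertex is its degree.
\<close>

definition max_degree :: "'a pair_pre_digraph \<Rightarrow> nat" where
  "max_degree G = Max (out_degree G ` pverts G)"

datatype node_status = Active | In_Cover | Terminated

record 'a node_state =
  status :: node_status
  active_nbrs :: "'a set"
  my_degree :: nat
  round_ctr :: nat

type_synonym 'a config = "'a \<Rightarrow> 'a node_state"

definition init_config :: "'a pair_pre_digraph \<Rightarrow> 'a config" where
  "init_config G v =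
     \<lparr>status = Active, active_nbrs = {u. v \<rightarrow>\<^bsub>G\<^esub> u}, my_degree = out_degree G v, round_ctr = 0\<rparr>"

text \<open>
  The local decision of a node at the start of a round; \<open>D\<close> is the maximum degree. A one-vertex
  network has \<open>D = 0\<close> and \<^term>\<open>log 2 0 = (0::real)\<close>; the test \<open>R > log 2 D\<close> then succeeds at
  \<open>R = 1\<close>, as it does under the reading \<open>log 0 = - \<infinity>\<close>.
\<close>

definition local_step :: "nat \<Rightarrow> 'a node_state \<Rightarrow> 'a node_state" where
  "local_step D x =
     (if status x = Active then
        let R = Suc (round_ctr x) in
        if real R > log 2 (real D) then x\<lparr>status := Terminated, round_ctr := R\<rparr>
        else if real (my_degree x) > real D / 2 ^ R then x\<lparr>status := In_Cover, round_ctr := R\<rparr>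
        else x\<lparr>round_ctr := R\<rparr>
      else x)"

definition declares :: "nat \<Rightarrow> 'a node_state \<Rightarrow> bool" where
  "declares D x \<longleftrightarrow> status x = Active \<and> status (local_step D x) = In_Cover"

definition drop_senders :: "'a pair_pre_digraph \<Rightarrow> 'a config \<Rightarrow> 'a \<Rightarrow> 'a set" where
  "drop_senders G c v =
     {u \<in> pverts G. declares (max_degree G) (c u) \<and> v \<in> active_nbrs (c u) \<and> my_degree (c v) \<noteq> 0}"

definition receive_drops :: "'a set \<Rightarrow> 'a node_state \<Rightarrow> 'a node_state" where
  "receive_drops S x = x\<lparr>active_nbrs := active_nbrs x - S, my_degree := my_degree x - card S\<rparr>"

text \<open>
  One synchronous round: all nodes decide simultaneously, and all messages of the round are
  delivered within it. Nodes that halted in an earlier round take no part.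
\<close>

definition round_step :: "'a pair_pre_digraph \<Rightarrow> 'a config \<Rightarrow> 'a config" where
  "round_step G c v =
     (if status (c v) = Active
      then receive_drops (drop_senders G c v) (local_step (max_degree G) (c v))
      else c v)"

definition config_after :: "'a pair_pre_digraph \<Rightarrow> nat \<Rightarrow> 'a config" where
  "config_after G t = (round_step G ^^ t) (init_config G)"

definition all_halted :: "'a pair_pre_digraph \<Rightarrow> 'a config \<Rightarrow> bool" where
  "all_halted G c \<longleftrightarrow> (\<forall>v \<in> pverts G. status (c v) \<noteq> Active)"

text \<open>
  A round costs one time unit, the last one (in which nodes terminate without sending) included.
  The value is \<open>\<infinity>\<close> if some node never halts.
\<close>

definition running_time :: "'a pair_pre_digraph \<Rightarrow> enat" where
  "running_time G = (INF t \<in> {t. all_halted G (config_after G t)}. enat t)"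

text \<open>
  The worst case over all networks on \<open>n\<close> nodes with identifiers in \<^typ>\<open>'a\<close>. Over an infinite type,
  such as \<^typ>\<open>nat\<close>, every finite graph occurs up to isomorphism. The supremum lives in \<^typ>\<open>enat\<close>
  because a supremum of an unbounded set of natural numbers would carry no information.
\<close>

definition worst_case_time :: "'a itself \<Rightarrow> nat \<Rightarrow> enat" where
  "worst_case_time _ n =
     (SUP G \<in> {G :: 'a pair_pre_digraph.
        pair_graph G \<and> Digraph_Component.connected (with_proj G) \<and> card (pverts G) = n}. running_time G)"

end

theory Submission
  imports Defs
begin

text \<open>
  Active nodes count rounds in lockstep, so the test \<open>R > log 2 D\<close> alone halts every node in the
  first round whose number exceeds \<open>log 2 D\<close>, whatever the cover decisions and drop messages were.
  Since \<open>D \<le> n\<close>, this happens after at most \<open>\<lfloor>log 2 n\<rfloor> + 1\<close> rounds.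
\<close>

lemma active_round_bound:
  assumes "status (config_after G t v) = Active"
  shows "round_ctr (config_after G t v) = t \<and> (t = 0 \<or> real t \<le> log 2 (max_degree G))"
  using assms
proof (induction t)
  case 0
  then show ?case by (simp add: config_after_def init_config_def)
next
  case (Suc t)
  have step: "config_after G (Suc t) v = round_step G (config_after G t) v"
    by (simp add: config_after_def)
  \<comment> \<open>Halting is permanent: \<open>round_step\<close> leaves a node that is not active
    unchanged.\<close>
  have active: "status (config_after G t v) = Active"
    using Suc.prems by (auto simp: step round_step_def split: if_splits)
  then have "round_ctr (config_after G t v) = t" using Suc.IH by blast
  \<comment> \<open>A node still active has passed the test with R = \<open>Suc t\<close>; drop
    messages alter neither its status nor its counter.\<close>
  then show ?case
    using Suc.prems active
    by (auto simp: step round_step_def receive_drops_def local_step_def Let_def split: if_splits)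
qed

lemma max_degree_le_card:
  assumes "pair_graph G" and "pverts G \<noteq> {}"
  shows "max_degree G \<le> card (pverts G)"
proof -
  interpret pair_graph G by fact
  have "out_degree G v \<le> card (pverts G)" for v
  proof -
    \<comment> \<open>Arcs are pairs, so an arc leaving v is determined by its head.\<close>
    have "out_arcs G v \<subseteq> Pair v ` pverts G"
      using in_arcsD2 by (auto simp: out_arcs_def)
    then have "out_degree G v \<le> card (Pair v ` pverts G)"
      unfolding out_degree_def by (intro card_mono) auto
    also have "\<dots> \<le> card (pverts G)" by (intro card_image_le) auto
    finally show ?thesis .
  qed
  then show ?thesis using assms(2) by (simp add: max_degree_def)
qed

lemma running_time_le:
  assumes "pair_graph G"
  shows "running_time G \<le> enat (Suc (nat \<lfloor>log 2 (card (pverts G))\<rfloor>))"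
proof -
  interpret pair_graph G by fact
  \<comment> \<open>The successor makes \<open>?t\<close> strictly larger than log 2 n, so surviving
    round \<open>?t\<close> is contradictory.\<close>
  let ?t = "Suc (nat \<lfloor>log 2 (card (pverts G))\<rfloor>)"
  have "status (config_after G ?t v) \<noteq> Active" if v: "v \<in> pverts G" for v
  proof
    assume "status (config_after G ?t v) = Active"
    from active_round_bound[OF this] have "real ?t \<le> log 2 (max_degree G)" by simp
    moreover have "log 2 (max_degree G) \<le> log 2 (card (pverts G))"
    \<comment> \<open>Monotonicity of log needs a positive argument. For degree 0 the default
      \<open>log 2 0 = 0\<close> is still at most log 2 n, as n \<ge> 1.\<close>
    proof (cases "max_degree G = 0")
      case True
      moreover have "card (pverts G) \<ge> 1" using v by (metis One_nat_def Suc_leI card_gt_0_iff empty_iff finite_verts with_proj_simps(1))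
      ultimately show ?thesis by (simp add: log_def)
    next
      case False
      moreover have "max_degree G \<le> card (pverts G)" using max_degree_le_card[OF assms] v by blast
      ultimately show ?thesis by simp
    qed
    ultimately show False by linarith
  qed
  then have "all_halted G (config_after G ?t)" by (simp add: all_halted_def)
  then show ?thesis unfolding running_time_def by (intro INF_lower) simp
qed

lemma worst_case_time_le: "worst_case_time TYPE('a) n \<le> enat (Suc (nat \<lfloor>log 2 n\<rfloor>))"
  unfolding worst_case_time_def using running_time_le by (intro SUP_least) blast

theorem theorem1:
  shows "(\<forall>n. worst_case_time TYPE('a) n \<noteq> \<infinity>) \<and>
    (\<lambda>n. real (the_enat (worst_case_time TYPE('a) n))) \<in> O(\<lambda>n. log 2 (real n))"
proof
  show finite: "\<forall>n. worst_case_time TYPE('a) n \<noteq> \<infinity>"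
    using worst_case_time_le by (metis enat_ord_simps(5) infinity_ileE)
  show "(\<lambda>n. real (the_enat (worst_case_time TYPE('a) n))) \<in> O(\<lambda>n. log 2 (real n))"
  \<comment> \<open>From n = 2 on, log 2 n \<ge> 1 absorbs the additive 1, which yields the factor
    2; at n = 1 the logarithm vanishes.\<close>
  proof (rule bigoI[of _ 2], rule eventually_sequentiallyI[of 2])
    fix n :: nat
    assume "2 \<le> n"
    then have log: "1 \<le> log 2 n" by simp
    \<comment> \<open>Finiteness gives \<open>the_enat\<close> its intended value.\<close>
    obtain m where m: "worst_case_time TYPE('a) n = enat m" using finite by auto
    then have "m \<le> Suc (nat \<lfloor>log 2 n\<rfloor>)" using worst_case_time_le by (metis enat_ord_simps(1))
    then have "real m \<le> 2 * log 2 n" using log by linarith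
    then show "norm (real (the_enat (worst_case_time TYPE('a) n))) \<le> 2 * norm (log 2 (real n))"
      using log m by simp
  qed
qed

end
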